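(* Let $\mathcal N$ be a von Neumann algebra, $\mathcal A\subseteq\mathcal N$ a weak-$*$ dense subalgebra and $\{|||\cdot|||_{L^{(n)}}\}_{n\ge1}$ a matrix Lipschitz semi-norm on $\mathcal A$. Then, for channels on $\mathcal N$ mapping $\mathcal A$ into $\mathcal A$: (1) $\mathrm{Cost}_L(\mathrm{id})=\mathrm{Cost}_L^{cb}(\mathrm{id})=0$. (2) For two channels $\Phi,\Psi:\mathcal N\to\mathcal N$, $$\mathrm{Cost}_L(\Phi\circ\Psi)\le\mathrm{Cost}_L(\Phi)+\mathrm{Cost}_L(\Psi),\qquad \mathrm{Cost}_L^{cb}(\Phi\circ\Psi)\le\mathrm{Cost}_L^{cb}(\Phi)+\mathrm{Cost}_L^{cb}(\Psi).$$ (3) For two channels $\Phi,\Psi$ and $p_1,p_2\in[0,1]$ with $p_1+p_2=1$, $$\mathrm{Cost}_L(p_1\Phi+p_2\Psi)\le p_1\mathrm{Cost}_L(\Phi)+p_2\mathrm{Cost}_L(\Psi).$$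
   Context: A channel on $\mathcal N$ is a normal unital completely positive map $\Phi:\mathcal N\to\mathcal N$; $\Phi^{(n)}=\mathrm{id}_{\mathbb M_n}\otimes\Phi$. $\mathcal A$ is a unital $*$-subalgebra. A matrix Lipschitz semi-norm on $\mathcal A$ is a family of semi-norms $|||\cdot|||_{L^{(n)}}:\mathbb M_n(\mathcal A)\to[0,\infty)$, $n\ge1$, such that (1) $|||\mathbf 1|||_{L^{(n)}}=0$; (2) $|||x|||_{L^{(n)}}=|||x^*|||_{L^{(n)}}$; (3) $|||x\oplus y|||_{L^{(n+m)}}=\max\{|||x|||_{L^{(n)}},|||y|||_{L^{(m)}}\}$; (4) $|||axb|||_{L^{(m)}}\le\|a\|_{op}|||x|||_{L^{(n)}}\|b\|_{op}$ for $x\in\mathbb M_n(\mathcal A)$, $a\in\mathbb M_{m\times n}$, $b\in\mathbb M_{n\times m}$. Write $|||\cdot|||_L=|||\cdot|||_{L^{(1)}}$. Costs (valued in $[0,\infty]$): $$\mathrm{Cost}_L(\Phi)=\sup_{x=x^*\in\mathcal A,\ |||x|||_L\le1}\|\Phi(x)-x\|_{op},\qquad \mathrm{Cost}_L^{cb}(\Phi)=\sup_{n\ge1}\ \sup_{x=x^*\in\mathbb M_n(\mathcal A),\ |||x|||_{L^{(n)}}\le1}\|\Phi^{(n)}(x)-x\|_{op}.$$ *)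

theory Defs
  imports
    "HOL-Analysis.Bounded_Linear_Function"
    "HOL-Analysis.L2_Norm"
    "HOL-Library.Extended_Nonnegative_Real"
    "HOL-Library.Nonpos_Ints"
    "Jordan_Normal_Form.Matrix"
begin

section \<open>Complex Hilbert spaces\<close>

class complex_vector = real_vector +
  fixes scaleC :: "complex \<Rightarrow> 'a \<Rightarrow> 'a" (infixr "*\<^sub>C" 75)
  assumes scaleC_add_right: "c *\<^sub>C (x + y) = c *\<^sub>C x + c *\<^sub>C y"
    and scaleC_add_left: "(c + d) *\<^sub>C x = c *\<^sub>C x + d *\<^sub>C x"
    and scaleC_scaleC: "c *\<^sub>C d *\<^sub>C x = (c * d) *\<^sub>C x"
    and scaleC_of_real: "complex_of_real r *\<^sub>C x = r *\<^sub>R x"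

text \<open>The inner product is linear in the second and conjugate-linear in the first argument.
  Completeness is part of \<^class>\<open>banach\<close>.\<close>

class complex_hilbert = complex_vector + banach +
  fixes cinner :: "'a \<Rightarrow> 'a \<Rightarrow> complex"
  assumes cinner_commute: "cinner x y = cnj (cinner y x)"
    and cinner_add_right: "cinner x (y + z) = cinner x y + cinner x z"
    and cinner_scaleC_right: "cinner x (c *\<^sub>C y) = c * cinner x y"
    and cinner_self: "cinner x x = complex_of_real ((norm x)\<^sup>2)"

lemma scaleC_zero_right [simp]: "c *\<^sub>C 0 = (0 :: 'a :: complex_vector)"
  using scaleC_add_right[of c 0 "0::'a"] by simp

lemma scaleC_zero_left [simp]: "0 *\<^sub>C x = (0 :: 'a :: complex_vector)"
  using scaleC_add_left[of 0 0 "x::'a"] by simp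

lemma scaleC_one [simp]: "1 *\<^sub>C x = (x :: 'a :: complex_vector)"
  using scaleC_of_real[of 1 x] by simp

lemma scaleC_minus_right: "c *\<^sub>C (- x) = - (c *\<^sub>C (x :: 'a :: complex_vector))"
  using scaleC_add_right[of c x "- x"] by (simp add: eq_neg_iff_add_eq_0 add.commute)

lemma scaleC_scaleR: "c *\<^sub>C (r *\<^sub>R x) = r *\<^sub>R (c *\<^sub>C (x :: 'a :: complex_vector))"
  by (metis mult.commute scaleC_of_real scaleC_scaleC)

lemma cinner_add_left: "cinner (x + y) z = cinner x z + cinner y z"
  by (metis cinner_commute cinner_add_right complex_cnj_add)

lemma cinner_scaleC_left: "cinner (c *\<^sub>C x) y = cnj c * cinner x y"
  by (metis cinner_commute cinner_scaleC_right complex_cnj_mult)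

lemma cinner_scaleR_right: "cinner x (r *\<^sub>R y) = complex_of_real r * cinner x y"
  by (metis cinner_scaleC_right scaleC_of_real)

lemma norm_add_square: "(norm (x + y))\<^sup>2 = (norm x)\<^sup>2 + (norm y)\<^sup>2 + 2 * Re (cinner x y)"
proof -
  have "complex_of_real ((norm (x + y))\<^sup>2) =
      of_real ((norm x)\<^sup>2) + of_real ((norm y)\<^sup>2) + (cinner x y + cnj (cinner x y))"
    by (metis (no_types, lifting) cinner_self cinner_add_left cinner_add_right cinner_commute
        add.assoc add.commute)
  from arg_cong[OF this, of Re] show ?thesis
    by (simp del: of_real_power)
qed

lemma norm_scaleC [simp]: "norm (c *\<^sub>C x) = cmod c * norm (x :: 'a :: complex_hilbert)"
proof -
  have "complex_of_real ((norm (c *\<^sub>C x))\<^sup>2) = (c * cnj c) * of_real ((norm x)\<^sup>2)"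
    by (metis cinner_self cinner_scaleC_left cinner_scaleC_right mult.assoc)
  also have "\<dots> = of_real ((cmod c * norm x)\<^sup>2)"
    by (simp only: complex_norm_square[symmetric] of_real_mult[symmetric] power_mult_distrib)
  finally have "(norm (c *\<^sub>C x))\<^sup>2 = (cmod c * norm x)\<^sup>2"
    using of_real_eq_iff by blast
  then show ?thesis
    by (simp add: power2_eq_iff_nonneg)
qed

lemma Re_cinner_le: "Re (cinner x y) \<le> norm x * norm y"
proof -
  have "(norm (x + y))\<^sup>2 \<le> (norm x + norm y)\<^sup>2"
    by (simp add: norm_triangle_ineq power_mono)
  then show ?thesis
    by (simp add: norm_add_square power2_sum)
qed

lemma cinner_Cauchy_Schwarz: "cmod (cinner x y) \<le> norm x * norm y"
proof (cases "cinner x y = 0")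
  case False
  define c where "c = cnj (cinner x y) / cmod (cinner x y)"
  have c: "cmod c = 1" using False by (simp add: c_def norm_divide)
  have "cinner x (c *\<^sub>C y) = of_real (cmod (cinner x y))"
    using False
    by (simp add: cinner_scaleC_right c_def field_simps complex_norm_square[symmetric]
        power2_eq_square)
  then have "cmod (cinner x y) = Re (cinner x (c *\<^sub>C y))" by simp
  also have "\<dots> \<le> norm x * norm (c *\<^sub>C y)" by (rule Re_cinner_le)
  finally show ?thesis using c by simp
qed simp

lemma cinner_ext: "(\<And>u. cinner x u = cinner y u) \<Longrightarrow> x = y"
proof -
  assume a: "\<And>u. cinner x u = cinner y u"
  have "cinner (x - y) (x - y) = 0"
    using a[of "x - y"] cinner_add_left[of "x - y" y "x - y"] by simp
  then show "x = y" by (simp add: cinner_self)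
qed


section \<open>Bounded operators\<close>

text \<open>\<open>'a bop\<close> is $B(H)$ for the Hilbert space $H$ given by \<open>'a\<close>: the complex-linear elements of the
  library's space of bounded real-linear maps, with the same norm.\<close>

typedef (overloaded) ('a :: complex_hilbert) bop =
    "{T :: 'a \<Rightarrow>\<^sub>L 'a. \<forall>c x. blinfun_apply T (c *\<^sub>C x) = c *\<^sub>C blinfun_apply T x}"
  morphisms blinfun_of_bop Abs_bop
  by (rule exI[of _ 0]) simp

setup_lifting type_definition_bop

lift_definition bop_apply :: "'a :: complex_hilbert bop \<Rightarrow> 'a \<Rightarrow> 'a" is blinfun_apply .

instantiation bop :: (complex_hilbert) "{ring, monoid_mult}"
begin
lift_definition zero_bop :: "'a bop" is 0 by simp
lift_definition one_bop :: "'a bop" is id_blinfun by simp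
lift_definition plus_bop :: "'a bop \<Rightarrow> 'a bop \<Rightarrow> 'a bop" is "(+)"
  by (simp add: blinfun.add_left scaleC_add_right)
lift_definition uminus_bop :: "'a bop \<Rightarrow> 'a bop" is uminus
  by (simp add: blinfun.minus_left scaleC_minus_right)
lift_definition minus_bop :: "'a bop \<Rightarrow> 'a bop \<Rightarrow> 'a bop" is "(-)"
  by (simp only: diff_conv_add_uminus blinfun.add_left blinfun.minus_left scaleC_minus_right
      scaleC_add_right mem_Collect_eq)
lift_definition times_bop :: "'a bop \<Rightarrow> 'a bop \<Rightarrow> 'a bop" is "(o\<^sub>L)" by simp
instance
  by standard (transfer; rule blinfun_eqI; simp add: blinfun.bilinear_simps)+
end

instantiation bop :: (complex_hilbert) real_normed_algebra
begin
lift_definition scaleR_bop :: "real \<Rightarrow> 'a bop \<Rightarrow> 'a bop" is scaleR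
  by (simp add: blinfun.scaleR_left scaleC_scaleR)
lift_definition norm_bop :: "'a bop \<Rightarrow> real" is norm .
definition dist_bop :: "'a bop \<Rightarrow> 'a bop \<Rightarrow> real"
  where "dist_bop S T = norm (S - T)"
definition sgn_bop :: "'a bop \<Rightarrow> 'a bop"
  where "sgn_bop T = inverse (norm T) *\<^sub>R T"
definition uniformity_bop :: "('a bop \<times> 'a bop) filter"
  where "uniformity_bop = (INF e\<in>{0 <..}. principal {(S, T). dist S T < e})"
definition open_bop :: "'a bop set \<Rightarrow> bool"
  where "open_bop U = (\<forall>S\<in>U. \<forall>\<^sub>F (S', T) in uniformity. S' = S \<longrightarrow> T \<in> U)"
instance
proof
  fix a b :: real and x y :: "'a bop"
  show "a *\<^sub>R (x + y) = a *\<^sub>R x + a *\<^sub>R y" by transfer (simp add: scaleR_add_right)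
  show "(a + b) *\<^sub>R x = a *\<^sub>R x + b *\<^sub>R x" by transfer (simp add: scaleR_add_left)
  show "a *\<^sub>R b *\<^sub>R x = (a * b) *\<^sub>R x" by transfer simp
  show "1 *\<^sub>R x = x" by transfer simp
  show "a *\<^sub>R x * y = a *\<^sub>R (x * y)"
    by transfer (rule blinfun_eqI, simp add: blinfun.bilinear_simps)
  show "x * a *\<^sub>R y = a *\<^sub>R (x * y)"
    by transfer (rule blinfun_eqI, simp add: blinfun.bilinear_simps)
  show "(norm x = 0) = (x = 0)" by transfer simp
  show "norm (x + y) \<le> norm x + norm y" by transfer (rule norm_triangle_ineq)
  show "norm (a *\<^sub>R x) = \<bar>a\<bar> * norm x" by transfer simp
  show "norm (x * y) \<le> norm x * norm y" by transfer (rule norm_blinfun_compose)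
qed (simp_all add: dist_bop_def sgn_bop_def uniformity_bop_def open_bop_def)
end

lemma bounded_linear_scaleC: "bounded_linear (\<lambda>x. c *\<^sub>C (x :: 'a :: complex_hilbert))"
  by (rule bounded_linear_intro[where K = "cmod c"])
    (simp_all add: scaleC_add_right scaleC_scaleR mult.commute)

instantiation bop :: (complex_hilbert) complex_vector
begin
lift_definition scaleC_bop :: "complex \<Rightarrow> 'a bop \<Rightarrow> 'a bop"
  is "\<lambda>c T. Blinfun (\<lambda>x. c *\<^sub>C x) o\<^sub>L T"
  by (simp add: bounded_linear_Blinfun_apply bounded_linear_scaleC scaleC_scaleC mult.commute)
instance
  by standard (transfer; rule blinfun_eqI;
      simp add: bounded_linear_Blinfun_apply bounded_linear_scaleC blinfun.bilinear_simps
        scaleC_add_left scaleC_add_right scaleC_scaleC scaleC_of_real)+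
end

lemma bop_apply_simps [simp]:
  "bop_apply 0 x = 0"
  "bop_apply 1 x = x"
  "bop_apply (S + T) x = bop_apply S x + bop_apply T x"
  "bop_apply (- T) x = - bop_apply T x"
  "bop_apply (S - T) x = bop_apply S x - bop_apply T x"
  "bop_apply (S * T) x = bop_apply S (bop_apply T x)"
  "bop_apply (c *\<^sub>C T) x = c *\<^sub>C bop_apply T x"
  "bop_apply (r *\<^sub>R T) x = r *\<^sub>R bop_apply T x"
  by (transfer; simp add: blinfun.bilinear_simps bounded_linear_Blinfun_apply
      bounded_linear_scaleC)+

lemma bop_eqI: "(\<And>x. bop_apply S x = bop_apply T x) \<Longrightarrow> S = T"
  by transfer (rule blinfun_eqI)

lemma bop_apply_scaleC: "bop_apply T (c *\<^sub>C x) = c *\<^sub>C bop_apply T x"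
  by transfer simp

lemma bounded_linear_bop_apply: "bounded_linear (bop_apply T)"
  by transfer (rule blinfun.bounded_linear_right)

lemma norm_bop_apply: "norm (bop_apply T x) \<le> norm T * norm x"
  by transfer (rule norm_blinfun)

definition adj :: "'a :: complex_hilbert bop \<Rightarrow> 'a bop" where
  "adj T = (THE S. \<forall>x y. cinner (bop_apply S x) y = cinner x (bop_apply T y))"

text \<open>Adjoints exist, by the Riesz representation theorem.\<close>

lemma Riesz_representation:
  fixes f :: "'a :: complex_hilbert \<Rightarrow> complex"
  assumes bl: "bounded_linear f" and f_scaleC: "\<And>c x. f (c *\<^sub>C x) = c * f x"
  shows "\<exists>z. \<forall>u. cinner z u = f u"
proof -
  interpret f: bounded_linear f by fact
  obtain K where K: "\<And>x. cmod (f x) \<le> norm x * K" using f.bounded by blast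
  define J where "J x = (norm x)\<^sup>2 - 2 * Re (f x)" for x
  have J_ge: "J x \<ge> - K\<^sup>2" for x
  proof -
    have "Re (f x) \<le> norm x * K" using K[of x] complex_Re_le_cmod[of "f x"] by linarith
    moreover have "0 \<le> (norm x - K)\<^sup>2" by simp
    ultimately show ?thesis by (simp add: J_def power2_diff)
  qed
  define m where "m = (INF x. J x)"
  have bdd: "bdd_below (range J)" using J_ge by (intro bdd_belowI) auto
  have m_le: "m \<le> J x" for x unfolding m_def using bdd by (rule cINF_lower) simp
  have "\<exists>x. J x < m + 1 / Suc n" for n
    using cInf_lessD[of "range J" "m + 1 / Suc n"] by (auto simp: m_def)
  then obtain X where X: "\<And>n. J (X n) < m + 1 / Suc n" by metis
  have mid: "(norm (x - y))\<^sup>2 = 2 * J x + 2 * J y - 4 * J ((1/2) *\<^sub>R (x + y))" for x y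
  proof -
    have "(norm (x - y))\<^sup>2 = 2 * (norm x)\<^sup>2 + 2 * (norm y)\<^sup>2 - (norm (x + y))\<^sup>2"
      using norm_add_square[of x y] norm_add_square[of x "- y"]
        cinner_scaleR_right[of x "-1" y] by simp
    moreover have "(norm ((1/2) *\<^sub>R (x + y)))\<^sup>2 = (norm (x + y))\<^sup>2 / 4"
      by (simp add: power_divide)
    moreover have "Re (f ((1/2) *\<^sub>R (x + y))) = (Re (f x) + Re (f y)) / 2"
      by (simp only: f.scaleR f.add) simp
    ultimately show ?thesis unfolding J_def by simp
  qed
  have dist: "(norm (X i - X j))\<^sup>2 < 4 / Suc n" if "i \<ge> n" "j \<ge> n" for i j n
  proof -
    have "1 / Suc i \<le> 1 / Suc n" "1 / Suc j \<le> 1 / Suc n" using that by (auto simp: frac_le)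
    then show ?thesis
      using mid[of "X i" "X j"] X[of i] X[of j] m_le[of "(1/2) *\<^sub>R (X i + X j)"] by linarith
  qed
  have "Cauchy X"
  proof (rule CauchyI)
    fix e :: real assume e: "e > 0"
    then obtain n where n: "n > 0" "inverse (real n) < e\<^sup>2 / 4"
      using ex_inverse_of_nat_less[of "e\<^sup>2 / 4"] by auto
    have "4 / Suc n < e\<^sup>2"
    proof -
      have "1 / Suc n \<le> inverse (real n)" using n(1) by (simp add: field_simps)
      then show ?thesis using n(2) by linarith
    qed
    then have "norm (X i - X j) < e" if "i \<ge> n" "j \<ge> n" for i j
      using dist[OF that] e by (intro power2_less_imp_less[of _ e]) auto
    then show "\<exists>M. \<forall>i\<ge>M. \<forall>j\<ge>M. norm (X i - X j) < e" by blast
  qed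
  then obtain z where z: "X \<longlonglongrightarrow> z" using convergent_eq_Cauchy by blast
  have "(\<lambda>n. J (X n)) \<longlonglongrightarrow> J z"
    unfolding J_def by (intro tendsto_intros z f.tendsto)
  moreover have "(\<lambda>n. m + 1 / real (Suc n)) \<longlonglongrightarrow> m + 0"
    by (intro tendsto_intros LIMSEQ_Suc[OF lim_1_over_n])
  ultimately have Jz: "J z \<le> m"
    using X by (intro LIMSEQ_le[of "\<lambda>n. J (X n)" "J z"]) (auto intro: less_imp_le)
  have re: "Re (cinner z u) = Re (f u)" for u
  proof -
    define b where "b = Re (cinner z u) - Re (f u)"
    have ge: "0 \<le> t\<^sup>2 * (norm u)\<^sup>2 + 2 * t * b" for t
    proof -
      have "J z \<le> J (z + t *\<^sub>R u)" using Jz m_le order_trans by blast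
      then show ?thesis
        by (simp add: J_def norm_add_square cinner_scaleR_right f.add f.scaleR b_def
            power_mult_distrib algebra_simps)
    qed
    have "b = 0"
    proof (cases "u = 0")
      case True
      then show ?thesis using ge[of "- b"] by (auto simp add: mult_le_0_iff)
    next
      case False
      define t where "t = - b / (norm u)\<^sup>2"
      have "t\<^sup>2 * (norm u)\<^sup>2 + 2 * t * b = - b\<^sup>2 / (norm u)\<^sup>2"
        using False by (simp add: t_def field_simps power2_eq_square)
      then have "b\<^sup>2 / (norm u)\<^sup>2 \<le> 0" using ge[of t] by simp
      then show ?thesis using False by (simp add: divide_le_0_iff)
    qed
    then show ?thesis by (simp add: b_def)
  qed
  have "Im (cinner z u) = Im (f u)" for u
    using re[of "\<i> *\<^sub>C u"] by (simp add: cinner_scaleC_right f_scaleC)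
  then show ?thesis using re complex_eq_iff by blast
qed

lemma cinner_adj_left: "cinner (bop_apply (adj T) x) y = cinner x (bop_apply T y)"
proof -
  have "\<exists>z. \<forall>u. cinner z u = cinner x (bop_apply T u)" for x
  proof (rule Riesz_representation)
    interpret T: bounded_linear "bop_apply T" by (rule bounded_linear_bop_apply)
    show "bounded_linear (\<lambda>u. cinner x (bop_apply T u))"
    proof (rule bounded_linear_intro[where K = "norm x * norm T"])
      show "cmod (cinner x (bop_apply T u)) \<le> norm u * (norm x * norm T)" for u
        using cinner_Cauchy_Schwarz[of x "bop_apply T u"]
          mult_left_mono[OF norm_bop_apply[of T u], of "norm x"] by (simp add: ac_simps)
    qed (simp_all add: T.add T.scaleR cinner_add_right cinner_scaleR_right scaleR_conv_of_real)
  qed (simp add: bop_apply_scaleC cinner_scaleC_right)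
  then obtain s where s: "\<And>x u. cinner (s x) u = cinner x (bop_apply T u)" by metis
  have bound: "norm (s x) \<le> norm x * norm T" for x
  proof -
    have "(norm (s x))\<^sup>2 = cmod (cinner (s x) (s x))"
      unfolding cinner_self norm_of_real by simp
    also have "\<dots> \<le> norm x * norm (bop_apply T (s x))"
      unfolding s by (rule cinner_Cauchy_Schwarz)
    also have "\<dots> \<le> norm x * (norm T * norm (s x))"
      by (intro mult_left_mono norm_bop_apply) simp
    finally have "norm (s x) * norm (s x) \<le> (norm x * norm T) * norm (s x)"
      by (simp add: power2_eq_square ac_simps)
    then show ?thesis by (cases "s x = 0") simp_all
  qed
  have add: "s (x + y) = s x + s y" for x y
    by (rule cinner_ext) (simp add: s cinner_add_left)
  have scale: "s (c *\<^sub>C x) = c *\<^sub>C s x" for c x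
    by (rule cinner_ext) (simp add: s cinner_scaleC_left)
  have bl: "bounded_linear s"
    by (rule bounded_linear_intro[where K = "norm T"])
      (simp_all add: add bound scale flip: scaleC_of_real)
  define S where "S = Abs_bop (Blinfun s)"
  have Sx: "bop_apply S x = s x" for x
    unfolding S_def bop_apply_def
    by (simp add: Abs_bop_inverse bounded_linear_Blinfun_apply[OF bl] scale)
  have "\<forall>x y. cinner (bop_apply (adj T) x) y = cinner x (bop_apply T y)"
    unfolding adj_def
  proof (rule theI)
    show "\<forall>x y. cinner (bop_apply S x) y = cinner x (bop_apply T y)" by (simp add: Sx s)
    fix S' assume "\<forall>x y. cinner (bop_apply S' x) y = cinner x (bop_apply T y)"
    then show "S' = S" by (intro bop_eqI cinner_ext) (simp add: Sx s)
  qed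
  then show ?thesis by blast
qed


section \<open>Von Neumann algebras\<close>

text \<open>The weak-$*$ (ultraweak, $\sigma$-weak) topology of $B(H)$ is the initial topology for the
  functionals $T \mapsto \sum_k \langle u_k, T v_k\rangle$ with square-summable $(u_k)$ and $(v_k)$;
  these form the predual of $B(H)$. The weak-$*$ topology of a von Neumann algebra $N$ on $H$ is the
  subspace topology.\<close>

definition ultraweak :: "'a :: complex_hilbert bop topology" where
  "ultraweak = topology_generated_by
    {{T. (\<Sum>k. cinner (u k) (bop_apply T (v k))) \<in> U} | u v U.
      summable (\<lambda>k. (norm (u k))\<^sup>2) \<and> summable (\<lambda>k. (norm (v k))\<^sup>2) \<and> open U}"

definition unital_star_subalgebra :: "'a :: complex_hilbert bop set \<Rightarrow> bool" where
  "unital_star_subalgebra A \<longleftrightarrow>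
    1 \<in> A \<and> (\<forall>S\<in>A. \<forall>T\<in>A. S + T \<in> A \<and> S * T \<in> A) \<and>
    (\<forall>c. \<forall>T\<in>A. c *\<^sub>C T \<in> A) \<and> (\<forall>T\<in>A. adj T \<in> A)"

definition von_neumann_algebra :: "'a :: complex_hilbert bop set \<Rightarrow> bool" where
  "von_neumann_algebra N \<longleftrightarrow> unital_star_subalgebra N \<and> closedin ultraweak N"

definition weak_star_dense_in :: "'a :: complex_hilbert bop set \<Rightarrow> 'a bop set \<Rightarrow> bool" where
  "weak_star_dense_in A N \<longleftrightarrow> A \<subseteq> N \<and> subtopology ultraweak N closure_of A = N"


section \<open>Matrices of operators\<close>

definition mats :: "nat \<Rightarrow> 'b set \<Rightarrow> 'b mat set" where
  "mats n A = {x \<in> carrier_mat n n. \<forall>i<n. \<forall>j<n. x $$ (i, j) \<in> A}"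

definition l2norm :: "'b :: real_normed_vector vec \<Rightarrow> real" where
  "l2norm v = L2_set (\<lambda>i. norm (v $ i)) {..<dim_vec v}"

definition opmat_apply :: "'a :: complex_hilbert bop mat \<Rightarrow> 'a vec \<Rightarrow> 'a vec" where
  "opmat_apply x \<xi> = vec (dim_row x) (\<lambda>i. \<Sum>j<dim_col x. bop_apply (x $$ (i, j)) (\<xi> $ j))"

text \<open>The operator norm of an $m \times n$ matrix of operators, as an operator $H^n \to H^m$, and that
  of a scalar matrix, as an operator $\mathbb{C}^n \to \mathbb{C}^m$.\<close>

definition opmat_norm :: "'a :: complex_hilbert bop mat \<Rightarrow> real" where
  "opmat_norm x = (SUP \<xi>\<in>{\<xi> \<in> carrier_vec (dim_col x). l2norm \<xi> \<le> 1}. l2norm (opmat_apply x \<xi>))"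

definition scalar_mat_norm :: "complex mat \<Rightarrow> real" where
  "scalar_mat_norm a = (SUP v\<in>{v \<in> carrier_vec (dim_col a). l2norm v \<le> 1}. l2norm (a *\<^sub>v v))"

definition opmat_adj :: "'a :: complex_hilbert bop mat \<Rightarrow> 'a bop mat" where
  "opmat_adj x = mat (dim_col x) (dim_row x) (\<lambda>(i, j). adj (x $$ (j, i)))"

definition opmat_positive :: "'a :: complex_hilbert bop mat \<Rightarrow> bool" where
  "opmat_positive x \<longleftrightarrow> dim_row x = dim_col x \<and>
    (\<forall>\<xi> \<in> carrier_vec (dim_col x).
      (\<Sum>i<dim_row x. cinner (\<xi> $ i) (opmat_apply x \<xi> $ i)) \<in> \<real>\<^sub>\<ge>\<^sub>0)"

definition opmat_scaleC :: "complex \<Rightarrow> 'a :: complex_hilbert bop mat \<Rightarrow> 'a bop mat" where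
  "opmat_scaleC c x = map_mat (scaleC c) x"

definition scalar_opmat :: "complex mat \<Rightarrow> 'a :: complex_hilbert bop mat" where
  "scalar_opmat a = map_mat (\<lambda>c. c *\<^sub>C 1) a"

definition opmat_dsum :: "'a :: complex_hilbert bop mat \<Rightarrow> 'a bop mat \<Rightarrow> 'a bop mat" where
  "opmat_dsum x y =
    four_block_mat x (0\<^sub>m (dim_row x) (dim_col y)) (0\<^sub>m (dim_row y) (dim_col x)) y"


section \<open>Channels\<close>

text \<open>A map on $N$ is a function on the whole operator type of which only the values on \<open>N\<close> matter.
  The amplification $\mathrm{id}_{M_n} \otimes \Phi$ is the entrywise application \<open>map_mat \<Phi>\<close>.\<close>

definition complex_linear_on ::
    "'a :: complex_hilbert bop set \<Rightarrow> ('a bop \<Rightarrow> 'a bop) \<Rightarrow> bool" where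
  "complex_linear_on N \<Phi> \<longleftrightarrow>
    (\<forall>S\<in>N. \<forall>T\<in>N. \<Phi> (S + T) = \<Phi> S + \<Phi> T) \<and> (\<forall>c. \<forall>T\<in>N. \<Phi> (c *\<^sub>C T) = c *\<^sub>C \<Phi> T)"

definition completely_positive_on ::
    "'a :: complex_hilbert bop set \<Rightarrow> ('a bop \<Rightarrow> 'a bop) \<Rightarrow> bool" where
  "completely_positive_on N \<Phi> \<longleftrightarrow>
    (\<forall>n\<ge>1. \<forall>x \<in> mats n N. opmat_positive x \<longrightarrow> opmat_positive (map_mat \<Phi> x))"

text \<open>Normality of a positive linear map is weak-$*$ continuity.\<close>

definition normal_on ::
    "'a :: complex_hilbert bop set \<Rightarrow> ('a bop \<Rightarrow> 'a bop) \<Rightarrow> bool" where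
  "normal_on N \<Phi> \<longleftrightarrow> continuous_map (subtopology ultraweak N) (subtopology ultraweak N) \<Phi>"

definition channel :: "'a :: complex_hilbert bop set \<Rightarrow> ('a bop \<Rightarrow> 'a bop) \<Rightarrow> bool" where
  "channel N \<Phi> \<longleftrightarrow> \<Phi> ` N \<subseteq> N \<and> complex_linear_on N \<Phi> \<and> \<Phi> 1 = 1 \<and>
    completely_positive_on N \<Phi> \<and> normal_on N \<Phi>"


section \<open>Matrix Lipschitz semi-norms and costs\<close>

text \<open>\<open>L n\<close> is the semi-norm on $M_n(A)$; only its values on \<open>mats n A\<close> for \<open>n \<ge> 1\<close> matter.\<close>

definition matrix_seminorm_on ::
    "nat \<Rightarrow> 'a :: complex_hilbert bop set \<Rightarrow> ('a bop mat \<Rightarrow> real) \<Rightarrow> bool" where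
  "matrix_seminorm_on n A q \<longleftrightarrow>
    (\<forall>x \<in> mats n A. 0 \<le> q x) \<and>
    (\<forall>x \<in> mats n A. \<forall>y \<in> mats n A. q (x + y) \<le> q x + q y) \<and>
    (\<forall>c. \<forall>x \<in> mats n A. q (opmat_scaleC c x) = cmod c * q x)"

definition matrix_lipschitz_seminorm ::
    "'a :: complex_hilbert bop set \<Rightarrow> (nat \<Rightarrow> 'a bop mat \<Rightarrow> real) \<Rightarrow> bool" where
  "matrix_lipschitz_seminorm A L \<longleftrightarrow>
    (\<forall>n\<ge>1. matrix_seminorm_on n A (L n)) \<and>
    (\<forall>n\<ge>1. L n (1\<^sub>m n) = 0) \<and>
    (\<forall>n\<ge>1. \<forall>x \<in> mats n A. L n x = L n (opmat_adj x)) \<and>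
    (\<forall>n\<ge>1. \<forall>m\<ge>1. \<forall>x \<in> mats n A. \<forall>y \<in> mats m A.
      L (n + m) (opmat_dsum x y) = max (L n x) (L m y)) \<and>
    (\<forall>n\<ge>1. \<forall>m\<ge>1. \<forall>x \<in> mats n A. \<forall>a \<in> carrier_mat m n. \<forall>b \<in> carrier_mat n m.
      L m (scalar_opmat a * x * scalar_opmat b) \<le> scalar_mat_norm a * L n x * scalar_mat_norm b)"

text \<open>\<open>Cost\<close> identifies $A$ with $M_1(A)$. In \<^typ>\<open>ennreal\<close>, $0 \cdot \infty = 0$.\<close>

definition Cost ::
    "'a :: complex_hilbert bop set \<Rightarrow> (nat \<Rightarrow> 'a bop mat \<Rightarrow> real) \<Rightarrow> ('a bop \<Rightarrow> 'a bop) \<Rightarrow> ennreal"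
  where
  "Cost A L \<Phi> =
    (SUP x \<in> {x \<in> A. adj x = x \<and> L 1 (mat 1 1 (\<lambda>_. x)) \<le> 1}. ennreal (norm (\<Phi> x - x)))"

definition Cost_cb ::
    "'a :: complex_hilbert bop set \<Rightarrow> (nat \<Rightarrow> 'a bop mat \<Rightarrow> real) \<Rightarrow> ('a bop \<Rightarrow> 'a bop) \<Rightarrow> ennreal"
  where
  "Cost_cb A L \<Phi> =
    (SUP n \<in> {1..}. SUP x \<in> {x \<in> mats n A. opmat_adj x = x \<and> L n x \<le> 1}.
      ennreal (opmat_norm (map_mat \<Phi> x - x)))"

end

theory Submission
  imports Defs
begin

text \<open>A channel \<open>\<Phi>\<close> need not preserve the Lipschitz ball, so the composition is split as
  $\Phi\Psi(x) - x = \Phi(\Psi(x) - x) + (\Phi(x) - x)$ and the first summand is controlled by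
  contractivity of $\Phi^{(n)}$ on self-adjoint matrices: if $-c \le y \le c$ then
  $-c \le \Phi^{(n)}(y) \le c$ by positivity and unitality, and for an operator with real quadratic
  form such a two-sided bound gives $\|\Phi^{(n)}(y)\| \le c$ by polarization.\<close>

section \<open>Tuples of vectors and the action of matrices on them\<close>

unbundle no vec_syntax

text \<open>Elements of H^n are encoded as functions on the naturals of which only the values below
  n matter. Sums, differences and multiples of tuples are then plain lambda terms, free of carrier
  and dimension conditions.\<close>

definition opmat_act :: "nat \<Rightarrow> 'a :: complex_hilbert bop mat \<Rightarrow> (nat \<Rightarrow> 'a) \<Rightarrow> nat \<Rightarrow> 'a" where
  "opmat_act n x f i = (\<Sum>j<n. bop_apply (x $$ (i, j)) (f j))"

definition tuple_norm :: "nat \<Rightarrow> (nat \<Rightarrow> 'a :: real_normed_vector) \<Rightarrow> real" where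
  "tuple_norm n f = L2_set (\<lambda>i. norm (f i)) {..<n}"

definition opmat_form ::
    "nat \<Rightarrow> 'a :: complex_hilbert bop mat \<Rightarrow> (nat \<Rightarrow> 'a) \<Rightarrow> (nat \<Rightarrow> 'a) \<Rightarrow> complex" where
  "opmat_form n x f g = (\<Sum>i<n. cinner (f i) (opmat_act n x g i))"

text \<open>Over the complex numbers this amounts to self-adjointness. In this form it can be read
  off from positivity, so it passes through a channel without a proof that channels commute with
  adjoints.\<close>

definition opmat_real_form :: "nat \<Rightarrow> 'a :: complex_hilbert bop mat \<Rightarrow> bool" where
  "opmat_real_form n x \<longleftrightarrow> (\<forall>f. opmat_form n x f f \<in> \<real>)"

text \<open>A norm bound without a supremum: for an n x n matrix, \<open>opmat_norm x\<close> turns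
  out to be the least nonnegative such c.\<close>

definition opmat_bound :: "nat \<Rightarrow> 'a :: complex_hilbert bop mat \<Rightarrow> real \<Rightarrow> bool" where
  "opmat_bound n x c \<longleftrightarrow> (\<forall>f. tuple_norm n (opmat_act n x f) \<le> c * tuple_norm n f)"

lemma bop_apply_vec:
  "bop_apply T 0 = 0"
  "bop_apply T (x + y) = bop_apply T x + bop_apply T y"
  "bop_apply T (x - y) = bop_apply T x - bop_apply T y"
  "bop_apply T (r *\<^sub>R x) = r *\<^sub>R bop_apply T x"
  by (transfer; simp add: blinfun.bilinear_simps)+

lemma cinner_zero_right [simp]: "cinner x 0 = 0"
  using cinner_scaleC_right[of x 0 0] by simp

lemma cinner_diff_right: "cinner x (y - z) = cinner x y - cinner x z"
  using cinner_add_right[of x "y - z" z] by simp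

lemma cinner_diff_left: "cinner (x - y) z = cinner x z - cinner y z"
  using cinner_add_left[of "x - y" y z] by simp

lemma cinner_scaleR_left: "cinner (r *\<^sub>R x) y = complex_of_real r * cinner x y"
  by (metis cinner_scaleC_left scaleC_of_real complex_cnj_complex_of_real)

lemma cinner_sum_right: "cinner x (\<Sum>i\<in>I. f i) = (\<Sum>i\<in>I. cinner x (f i))"
  by (induction I rule: infinite_finite_induct) (simp_all add: cinner_add_right)

lemma tuple_norm_nonneg [simp]: "0 \<le> tuple_norm n f"
  by (simp add: tuple_norm_def L2_set_nonneg)

lemma tuple_norm_power2: "(tuple_norm n f)\<^sup>2 = (\<Sum>i<n. (norm (f i))\<^sup>2)"
  by (simp add: tuple_norm_def L2_set_def sum_nonneg)

lemma tuple_norm_add: "tuple_norm n (\<lambda>i. f i + g i) \<le> tuple_norm n f + tuple_norm n g"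
proof -
  have "tuple_norm n (\<lambda>i. f i + g i) \<le> L2_set (\<lambda>i. norm (f i) + norm (g i)) {..<n}"
    unfolding tuple_norm_def by (intro L2_set_mono norm_triangle_ineq) simp_all
  also have "\<dots> \<le> tuple_norm n f + tuple_norm n g"
    unfolding tuple_norm_def by (rule L2_set_triangle_ineq)
  finally show ?thesis .
qed

lemma tuple_norm_scaleR: "tuple_norm n (\<lambda>i. r *\<^sub>R f i) = \<bar>r\<bar> * tuple_norm n f"
  by (simp add: tuple_norm_def L2_set_right_distrib)

lemma norm_le_tuple_norm: "i < n \<Longrightarrow> norm (f i) \<le> tuple_norm n f"
  unfolding tuple_norm_def by (rule member_le_L2_set) simp_all

lemma l2norm_vec: "l2norm (vec n f) = tuple_norm n f"
  by (auto simp: l2norm_def tuple_norm_def intro!: L2_set_cong)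

lemma tuple_norm_vec_index: "v \<in> carrier_vec n \<Longrightarrow> tuple_norm n (\<lambda>i. v $ i) = l2norm v"
  by (auto simp: l2norm_def tuple_norm_def)

lemma opmat_apply_eq:
  assumes "x \<in> carrier_mat n n"
  shows "opmat_apply x v = vec n (opmat_act n x (\<lambda>i. v $ i))"
  using assms by (auto simp: opmat_apply_def opmat_act_def)

lemma opmat_act_vec_index: "opmat_act n x (\<lambda>i. vec n f $ i) = opmat_act n x f"
  by (rule ext) (simp add: opmat_act_def)

lemma opmat_act_scaleR: "opmat_act n x (\<lambda>i. r *\<^sub>R f i) = (\<lambda>i. r *\<^sub>R opmat_act n x f i)"
  by (rule ext) (simp add: opmat_act_def bop_apply_vec scaleR_sum_right)

lemma opmat_act_add:
  assumes "x \<in> carrier_mat n n" "y \<in> carrier_mat n n" "i < n"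
  shows "opmat_act n (x + y) f i = opmat_act n x f i + opmat_act n y f i"
  using assms by (simp add: opmat_act_def sum.distrib)

lemma opmat_act_diff:
  assumes "x \<in> carrier_mat n n" "y \<in> carrier_mat n n" "i < n"
  shows "opmat_act n (x - y) f i = opmat_act n x f i - opmat_act n y f i"
  using assms by (simp add: opmat_act_def sum_subtractf)

text \<open>The sum of the norms of all entries serves as K. Only its finiteness matters:
  \<open>opmat_norm\<close> is a real supremum and carries information only once the set is known to
  be bounded.\<close>

lemma opmat_act_finite_bound: "\<exists>K. \<forall>f. tuple_norm n (opmat_act n x f) \<le> K * tuple_norm n f"
proof (intro exI allI)
  fix f
  have "tuple_norm n (opmat_act n x f) \<le> (\<Sum>i<n. norm (opmat_act n x f i))"
    unfolding tuple_norm_def by (rule L2_set_le_sum) simp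
  also have "\<dots> \<le> (\<Sum>i<n. \<Sum>j<n. norm (x $$ (i, j)) * tuple_norm n f)"
  proof (intro sum_mono)
    fix i
    have "norm (opmat_act n x f i) \<le> (\<Sum>j<n. norm (bop_apply (x $$ (i, j)) (f j)))"
      unfolding opmat_act_def by (rule norm_sum)
    also have "\<dots> \<le> (\<Sum>j<n. norm (x $$ (i, j)) * tuple_norm n f)"
      by (intro sum_mono order_trans[OF norm_bop_apply] mult_left_mono norm_le_tuple_norm) auto
    finally show "norm (opmat_act n x f i) \<le> (\<Sum>j<n. norm (x $$ (i, j)) * tuple_norm n f)" .
  qed
  finally show "tuple_norm n (opmat_act n x f) \<le> (\<Sum>i<n. \<Sum>j<n. norm (x $$ (i, j))) * tuple_norm n f"
    by (simp add: sum_distrib_right)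
qed

section \<open>The operator norm as the least bound\<close>

lemma opmat_norm_le:
  fixes x :: "'a :: complex_hilbert bop mat"
  assumes "x \<in> carrier_mat n n" "opmat_bound n x c" "0 \<le> c"
  shows "opmat_norm x \<le> c"
  unfolding opmat_norm_def
proof (rule cSUP_least)
  \<comment> \<open>A real supremum is controlled by an upper bound only over a nonempty set; the
    zero vector shows that the unit ball is one.\<close>
  have "l2norm (vec n (\<lambda>_. 0 :: 'a)) = 0" by (simp add: l2norm_def L2_set_def)
  then have zero: "vec n (\<lambda>_. 0 :: 'a) \<in> {\<xi> \<in> carrier_vec (dim_col x). l2norm \<xi> \<le> 1}"
    using assms(1) by simp
  show "{\<xi> :: 'a vec. \<xi> \<in> carrier_vec (dim_col x) \<and> l2norm \<xi> \<le> 1} \<noteq> {}"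
    by (rule ex_in_conv[THEN iffD1], rule exI, rule zero)
next
  fix \<xi> :: "'a vec" assume "\<xi> \<in> {\<xi> \<in> carrier_vec (dim_col x). l2norm \<xi> \<le> 1}"
  then have xi: "\<xi> \<in> carrier_vec n" "l2norm \<xi> \<le> 1" using assms(1) by auto
  have "l2norm (opmat_apply x \<xi>) \<le> c * l2norm \<xi>"
    using assms(2) xi(1)
    by (simp add: opmat_apply_eq[OF assms(1)] l2norm_vec opmat_bound_def
        flip: tuple_norm_vec_index)
  also have "\<dots> \<le> c" using xi(2) assms(3) by (simp add: mult_left_le)
  finally show "l2norm (opmat_apply x \<xi>) \<le> c" .
qed

lemma tuple_norm_act_le_opmat_norm:
  assumes "x \<in> carrier_mat n n" "tuple_norm n f \<le> 1"
  shows "tuple_norm n (opmat_act n x f) \<le> opmat_norm x"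
proof -
  obtain K where K: "\<And>f. tuple_norm n (opmat_act n x f) \<le> K * tuple_norm n f"
    using opmat_act_finite_bound by blast
  have "l2norm (opmat_apply x \<xi>) \<le> \<bar>K\<bar>"
    if "\<xi> \<in> carrier_vec (dim_col x)" "l2norm \<xi> \<le> 1" for \<xi>
  proof -
    have xi: "\<xi> \<in> carrier_vec n" using that assms(1) by simp
    have "l2norm (opmat_apply x \<xi>) \<le> K * l2norm \<xi>"
      using K[of "\<lambda>i. \<xi> $ i"]
      by (simp add: opmat_apply_eq[OF assms(1)] l2norm_vec tuple_norm_vec_index[OF xi])
    also have "\<dots> \<le> \<bar>K\<bar> * 1"
      using that(2) tuple_norm_nonneg[of n "\<lambda>i. \<xi> $ i"]
      by (intro mult_mono) (auto simp: tuple_norm_vec_index[OF xi])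
    finally show ?thesis by simp
  qed
  then have bdd: "bdd_above ((\<lambda>\<xi>. l2norm (opmat_apply x \<xi>)) `
      {\<xi> \<in> carrier_vec (dim_col x). l2norm \<xi> \<le> 1})"
    by (intro bdd_aboveI2) auto
  have "l2norm (opmat_apply x (vec n f)) \<le> opmat_norm x"
    unfolding opmat_norm_def by (rule cSUP_upper[OF _ bdd]) (use assms in \<open>auto simp: l2norm_vec\<close>)
  then show ?thesis
    by (simp add: opmat_apply_eq[OF assms(1)] l2norm_vec opmat_act_vec_index)
qed

lemma opmat_norm_nonneg:
  fixes x :: "'a :: complex_hilbert bop mat"
  assumes "x \<in> carrier_mat n n"
  shows "0 \<le> opmat_norm x"
proof -
  have "tuple_norm n (\<lambda>_. 0 :: 'a) \<le> 1" by (simp add: tuple_norm_def L2_set_def)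
  then show ?thesis
    using tuple_norm_act_le_opmat_norm[OF assms] tuple_norm_nonneg order_trans by blast
qed

lemma opmat_bound_opmat_norm:
  fixes x :: "'a :: complex_hilbert bop mat"
  assumes "x \<in> carrier_mat n n"
  shows "opmat_bound n x (opmat_norm x)"
  unfolding opmat_bound_def
proof
  fix f :: "nat \<Rightarrow> 'a"
  define t where "t = tuple_norm n f"
  obtain K where K: "\<And>g. tuple_norm n (opmat_act n x g) \<le> K * tuple_norm n g"
    using opmat_act_finite_bound by blast
  have "tuple_norm n (opmat_act n x f) \<le> opmat_norm x * t"
  proof (cases "t = 0")
    \<comment> \<open>Such an f cannot be normalised, but the crude bound K already forces its image
      to have norm 0.\<close>
    case True
    then show ?thesis using K[of f] by (simp add: t_def)
  next
    case False
    then have t: "t > 0" using tuple_norm_nonneg[of n f] by (simp add: t_def less_le)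
    have "tuple_norm n (opmat_act n x (\<lambda>i. inverse t *\<^sub>R f i)) \<le> opmat_norm x"
      by (rule tuple_norm_act_le_opmat_norm[OF assms]) (use t in \<open>simp add: tuple_norm_scaleR flip: t_def\<close>)
    then show ?thesis
      using t by (simp add: opmat_act_scaleR tuple_norm_scaleR field_simps)
  qed
  then show "tuple_norm n (opmat_act n x f) \<le> opmat_norm x * tuple_norm n f" by (simp add: t_def)
qed

lemma opmat_norm_triangle:
  assumes "x \<in> carrier_mat n n" "y \<in> carrier_mat n n"
  shows "opmat_norm (x + y) \<le> opmat_norm x + opmat_norm y"
proof (rule opmat_norm_le)
  show "opmat_bound n (x + y) (opmat_norm x + opmat_norm y)"
    unfolding opmat_bound_def
  proof
    fix f
    have "tuple_norm n (opmat_act n (x + y) f) =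
        tuple_norm n (\<lambda>i. opmat_act n x f i + opmat_act n y f i)"
      unfolding tuple_norm_def by (rule L2_set_cong) (simp_all add: opmat_act_add[OF assms])
    also have "\<dots> \<le> tuple_norm n (opmat_act n x f) + tuple_norm n (opmat_act n y f)"
      by (rule tuple_norm_add)
    also have "\<dots> \<le> opmat_norm x * tuple_norm n f + opmat_norm y * tuple_norm n f"
      using opmat_bound_opmat_norm[OF assms(1)] opmat_bound_opmat_norm[OF assms(2)]
      unfolding opmat_bound_def by (intro add_mono) blast+
    finally show "tuple_norm n (opmat_act n (x + y) f) \<le>
        (opmat_norm x + opmat_norm y) * tuple_norm n f"
      by (simp add: distrib_right)
  qed
qed (use assms opmat_norm_nonneg[OF assms(1)] opmat_norm_nonneg[OF assms(2)] in auto)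

section \<open>Sesquilinear forms, polarization and the norm of a matrix with real form\<close>

lemma Re_opmat_form_le: "\<bar>Re (opmat_form n x f g)\<bar> \<le> tuple_norm n f * tuple_norm n (opmat_act n x g)"
proof -
  have "\<bar>Re (opmat_form n x f g)\<bar> \<le> cmod (opmat_form n x f g)" by (rule abs_Re_le_cmod)
  \<comment> \<open>Cauchy-Schwarz in H for each coordinate; afterwards it is applied once more in
    \<real>^n, to the tuples of norms.\<close>
  also have "\<dots> \<le> (\<Sum>i<n. \<bar>norm (f i)\<bar> * \<bar>norm (opmat_act n x g i)\<bar>)"
    unfolding opmat_form_def
    by (rule order_trans[OF norm_sum]) (auto intro!: sum_mono cinner_Cauchy_Schwarz)
  also have "\<dots> \<le> tuple_norm n f * tuple_norm n (opmat_act n x g)"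
    unfolding tuple_norm_def by (rule L2_set_mult_ineq)
  finally show ?thesis .
qed

lemma opmat_form_diff:
  assumes "x \<in> carrier_mat n n" "y \<in> carrier_mat n n"
  shows "opmat_form n (x - y) f g = opmat_form n x f g - opmat_form n y f g"
  using assms by (simp add: opmat_form_def opmat_act_diff cinner_diff_right sum_subtractf)

lemma opmat_real_form_diff:
  assumes "x \<in> carrier_mat n n" "y \<in> carrier_mat n n" "opmat_real_form n x" "opmat_real_form n y"
  shows "opmat_real_form n (x - y)"
  using assms by (simp add: opmat_real_form_def opmat_form_diff)

lemma opmat_form_expand:
  "opmat_form n x f g = (\<Sum>i<n. \<Sum>j<n. cinner (f i) (bop_apply (x $$ (i, j)) (g j)))"
  by (simp add: opmat_form_def opmat_act_def cinner_sum_right)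

lemma cnj_opmat_form_self:
  assumes "x \<in> carrier_mat n n" "opmat_adj x = x"
  shows "cnj (opmat_form n x f g) = opmat_form n x g f"
proof -
  have adj: "x $$ (j, i) = adj (x $$ (i, j))" if "i < n" "j < n" for i j
  proof -
    have "x $$ (j, i) = opmat_adj x $$ (j, i)" by (simp add: assms(2))
    also have "\<dots> = adj (x $$ (i, j))" using that assms(1) by (simp add: opmat_adj_def)
    finally show ?thesis .
  qed
  have "cnj (opmat_form n x f g) =
      (\<Sum>i<n. \<Sum>j<n. cinner (bop_apply (x $$ (i, j)) (g j)) (f i))"
    by (simp add: opmat_form_expand flip: cinner_commute)
  also have "\<dots> = (\<Sum>i<n. \<Sum>j<n. cinner (g j) (bop_apply (x $$ (j, i)) (f i)))"
  proof (intro sum.cong refl)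
    fix i j assume ij: "i \<in> {..<n}" "j \<in> {..<n}"
    then have "x $$ (i, j) = adj (x $$ (j, i))" using adj[of j i] by simp
    then show "cinner (bop_apply (x $$ (i, j)) (g j)) (f i) =
        cinner (g j) (bop_apply (x $$ (j, i)) (f i))"
      by (simp add: cinner_adj_left)
  qed
  also have "\<dots> = opmat_form n x g f"
    unfolding opmat_form_expand by (rule sum.swap)
  finally show ?thesis .
qed

lemma opmat_real_form_self_adjoint:
  assumes "x \<in> carrier_mat n n" "opmat_adj x = x"
  shows "opmat_real_form n x"
  using cnj_opmat_form_self[OF assms] by (simp add: opmat_real_form_def Reals_cnj_iff)

text \<open>The terms in (f, f) and (g, g) cancel and the cross terms double. After expansion this
  is checked in each summand of the double sum.\<close>

lemma opmat_form_polarization: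
  "opmat_form n x (\<lambda>i. f i + g i) (\<lambda>i. f i + g i) - opmat_form n x (\<lambda>i. f i - g i) (\<lambda>i. f i - g i)
    = 2 * (opmat_form n x f g + opmat_form n x g f)"
  unfolding opmat_form_expand sum_subtractf[symmetric] sum.distrib[symmetric] sum_distrib_left
  by (intro sum.cong refl) (simp add: bop_apply_vec cinner_add_left cinner_add_right
      cinner_diff_left cinner_diff_right)

text \<open>Polarize f against i g. Realness makes the imaginary part of the left side 0, while
  conjugate-linearity in the first argument turns the right side into 2 i (form(f, g) - form(g, f)),
  whose imaginary part is twice the difference of the two real parts.\<close>

lemma Re_opmat_form_commute:
  assumes "opmat_real_form n x"
  shows "Re (opmat_form n x f g) = Re (opmat_form n x g f)"
proof -
  define ig where "ig i = \<i> *\<^sub>C g i" for i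
  have fig: "opmat_form n x f ig = \<i> * opmat_form n x f g"
    by (simp add: opmat_form_expand ig_def bop_apply_scaleC cinner_scaleC_right sum_distrib_left)
  have igf: "opmat_form n x ig f = - \<i> * opmat_form n x g f"
    by (simp add: opmat_form_expand ig_def cinner_scaleC_left sum_distrib_left sum_negf)
  have "Im (opmat_form n x (\<lambda>i. f i + ig i) (\<lambda>i. f i + ig i)) = 0"
    "Im (opmat_form n x (\<lambda>i. f i - ig i) (\<lambda>i. f i - ig i)) = 0"
    using assms by (auto simp: opmat_real_form_def complex_is_Real_iff)
  then show ?thesis
    using arg_cong[OF opmat_form_polarization[of n x f ig], of Im] by (simp add: fig igf)
qed

lemma tuple_norm_parallelogram:
  fixes f g :: "nat \<Rightarrow> 'a :: complex_hilbert"
  shows "(tuple_norm n (\<lambda>i. f i + g i))\<^sup>2 + (tuple_norm n (\<lambda>i. f i - g i))\<^sup>2 =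
    2 * (tuple_norm n f)\<^sup>2 + 2 * (tuple_norm n g)\<^sup>2"
proof -
  have "(norm (u + v))\<^sup>2 + (norm (u - v))\<^sup>2 = 2 * (norm u)\<^sup>2 + 2 * (norm v)\<^sup>2" for u v :: 'a
    using norm_add_square[of u v] norm_add_square[of u "- v"] cinner_scaleR_right[of u "-1" v]
    by simp
  then show ?thesis
    by (simp add: tuple_norm_power2 sum_distrib_left flip: sum.distrib)
qed

text \<open>The matrix version of the fact that the norm of a self-adjoint operator is its numerical
  radius. The diagonal bound is first extended to pairs (h, f) and then tested at a multiple of the
  image of f.\<close>

lemma opmat_bound_of_form:
  assumes "opmat_real_form n x" "0 \<le> c"
    and form: "\<And>f. \<bar>Re (opmat_form n x f f)\<bar> \<le> c * (tuple_norm n f)\<^sup>2"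
  shows "opmat_bound n x c"
  unfolding opmat_bound_def
proof
  fix f
  define g where "g = opmat_act n x f"
  \<comment> \<open>Polarization isolates the cross terms, which have equal real parts, and the
    parallelogram identity adds up the two diagonal bounds.\<close>
  have bd: "2 * Re (opmat_form n x h f) \<le> c * ((tuple_norm n h)\<^sup>2 + (tuple_norm n f)\<^sup>2)" for h
  proof -
    have "4 * Re (opmat_form n x h f) = Re (opmat_form n x (\<lambda>i. h i + f i) (\<lambda>i. h i + f i))
        - Re (opmat_form n x (\<lambda>i. h i - f i) (\<lambda>i. h i - f i))"
      using arg_cong[OF opmat_form_polarization[of n x h f], of Re]
        Re_opmat_form_commute[OF assms(1), of h f] by simp
    also have "\<dots> \<le> c * (tuple_norm n (\<lambda>i. h i + f i))\<^sup>2 + c * (tuple_norm n (\<lambda>i. h i - f i))\<^sup>2"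
      using form[of "\<lambda>i. h i + f i"] form[of "\<lambda>i. h i - f i"] by linarith
    also have "\<dots> = 2 * (c * ((tuple_norm n h)\<^sup>2 + (tuple_norm n f)\<^sup>2))"
      unfolding distrib_left[symmetric] tuple_norm_parallelogram by (simp add: algebra_simps)
    finally show ?thesis by simp
  qed
  have gg: "Re (opmat_form n x (\<lambda>i. t *\<^sub>R g i) f) = t * (tuple_norm n g)\<^sup>2" for t
    by (simp add: opmat_form_def g_def[symmetric] cinner_scaleR_left cinner_self tuple_norm_power2
        sum_distrib_left del: of_real_power)
  \<comment> \<open>The test tuple is h = t g with g the image of f, so the form at (h, f) is t
    times the squared norm of g. The choice t = 1/c makes the two terms in g combine to the
    claim.\<close>
  have bd': "2 * (t * (tuple_norm n g)\<^sup>2) \<le> c * (t\<^sup>2 * (tuple_norm n g)\<^sup>2 + (tuple_norm n f)\<^sup>2)" for t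
    using bd[of "\<lambda>i. t *\<^sub>R g i"] by (simp add: gg tuple_norm_scaleR power_mult_distrib)
  have "(tuple_norm n g)\<^sup>2 \<le> (c * tuple_norm n f)\<^sup>2"
  proof (cases "c = 0")
    case True
    then show ?thesis using bd'[of 1] by simp
  next
    case False
    then have "c > 0" using assms(2) by simp
    then show ?thesis using bd'[of "1 / c"]
      by (simp add: field_simps power2_eq_square)
  qed
  then show "tuple_norm n (opmat_act n x f) \<le> c * tuple_norm n f"
    using assms(2) by (simp add: g_def power2_le_iff_abs_le abs_le_iff)
qed

section \<open>Shifts c 1 + s x and their positivity\<close>

definition opmat_shift :: "nat \<Rightarrow> real \<Rightarrow> real \<Rightarrow> 'a :: complex_hilbert bop mat \<Rightarrow> 'a bop mat" where
  "opmat_shift n c s x = mat n n (\<lambda>(i, j).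
    of_real (if i = j then c else 0) *\<^sub>C 1 + of_real s *\<^sub>C x $$ (i, j))"

lemma opmat_form_shift:
  "opmat_form n (opmat_shift n c s x) f f =
    of_real (c * (tuple_norm n f)\<^sup>2) + of_real s * opmat_form n x f f"
proof -
  have "opmat_form n (opmat_shift n c s x) f f =
      (\<Sum>i<n. \<Sum>j<n. of_real (if i = j then c else 0) * cinner (f i) (f j)) +
      of_real s * opmat_form n x f f"
    by (simp add: opmat_form_expand opmat_shift_def cinner_add_right cinner_scaleC_right
        sum.distrib sum_distrib_left)
  also have "(\<Sum>i<n. \<Sum>j<n. of_real (if i = j then c else 0) * cinner (f i) (f j)) =
      (\<Sum>i<n. \<Sum>j<n. if i = j then of_real c * cinner (f i) (f j) else 0)"
    by (intro sum.cong refl) simp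
  also have "\<dots> = of_real (c * (tuple_norm n f)\<^sup>2)"
    by (simp add: tuple_norm_power2 cinner_self sum_distrib_left)
  finally show ?thesis .
qed

text \<open>Passes from vectors of dimension n to function tuples: each tuple restricts to such a
  vector, and the form sees only indices below n.\<close>

lemma opmat_positive_iff:
  assumes "x \<in> carrier_mat n n"
  shows "opmat_positive x \<longleftrightarrow> (\<forall>f. opmat_form n x f f \<in> \<real>\<^sub>\<ge>\<^sub>0)"
proof -
  have *: "(\<Sum>i<dim_row x. cinner (v $ i) (opmat_apply x v $ i)) = opmat_form n x (\<lambda>i. v $ i) (\<lambda>i. v $ i)" for v
    using assms by (auto simp: opmat_form_def opmat_apply_eq)
  have **: "opmat_form n x (\<lambda>i. vec n f $ i) (\<lambda>i. vec n f $ i) = opmat_form n x f f" for f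
    by (simp add: opmat_form_def opmat_act_vec_index)
  show ?thesis
  proof
    assume pos: "opmat_positive x"
    have "opmat_form n x f f \<in> \<real>\<^sub>\<ge>\<^sub>0" for f
    proof -
      have "vec n f \<in> carrier_vec (dim_col x)" using assms by simp
      then have "opmat_form n x (\<lambda>i. vec n f $ i) (\<lambda>i. vec n f $ i) \<in> \<real>\<^sub>\<ge>\<^sub>0"
        using pos unfolding opmat_positive_def * by blast
      then show ?thesis by (simp only: **)
    qed
    then show "\<forall>f. opmat_form n x f f \<in> \<real>\<^sub>\<ge>\<^sub>0" ..
  next
    assume "\<forall>f. opmat_form n x f f \<in> \<real>\<^sub>\<ge>\<^sub>0"
    then show "opmat_positive x"
      using assms unfolding opmat_positive_def * by simp
  qed
qed

text \<open>As s is real and nonzero, the shifted form can be real only if the form of x is.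
  Positivity of one shift thus yields realness together with a one-sided bound, and the signs s = 1
  and s = -1 together express -c \<le> x \<le> c.\<close>

lemma opmat_positive_shift_iff:
  assumes "s \<noteq> 0"
  shows "opmat_positive (opmat_shift n c s x) \<longleftrightarrow>
    opmat_real_form n x \<and> (\<forall>f. 0 \<le> c * (tuple_norm n f)\<^sup>2 + s * Re (opmat_form n x f f))"
proof -
  have "opmat_shift n c s x \<in> carrier_mat n n" by (simp add: opmat_shift_def)
  then have "opmat_positive (opmat_shift n c s x) \<longleftrightarrow>
      (\<forall>f. of_real (c * (tuple_norm n f)\<^sup>2) + of_real s * opmat_form n x f f \<in> \<real>\<^sub>\<ge>\<^sub>0)"
    unfolding opmat_form_shift[symmetric] by (rule opmat_positive_iff)
  also have "\<dots> \<longleftrightarrow> (\<forall>f. opmat_form n x f f \<in> \<real> \<and>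
      0 \<le> c * (tuple_norm n f)\<^sup>2 + s * Re (opmat_form n x f f))"
  proof -
    have "complex_of_real a + of_real s * q \<in> \<real>\<^sub>\<ge>\<^sub>0 \<longleftrightarrow> q \<in> \<real> \<and> 0 \<le> a + s * Re q" for a q
      using assms by (auto simp: complex_nonneg_Reals_iff complex_is_Real_iff)
    then show ?thesis by (simp only:)
  qed
  finally show ?thesis
    unfolding opmat_real_form_def by blast
qed

section \<open>Contractivity of channels and the estimate for a composition\<close>

lemma matsI: "x \<in> carrier_mat n n \<Longrightarrow> (\<And>i j. i < n \<Longrightarrow> j < n \<Longrightarrow> x $$ (i, j) \<in> A) \<Longrightarrow> x \<in> mats n A"
  by (simp add: mats_def)

lemma mats_carrier: "x \<in> mats n A \<Longrightarrow> x \<in> carrier_mat n n"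
  by (simp add: mats_def)

lemma unital_star_subalgebra_diff:
  assumes "unital_star_subalgebra A" "S \<in> A" "T \<in> A"
  shows "S - T \<in> A"
proof -
  have "S + (-1) *\<^sub>C T \<in> A" using assms by (simp add: unital_star_subalgebra_def)
  moreover have "(-1) *\<^sub>C T = - T" using scaleC_of_real[of "-1" T] by simp
  ultimately show ?thesis by simp
qed

lemma complex_linear_on_diff:
  assumes "unital_star_subalgebra N" "complex_linear_on N \<Phi>" "S \<in> N" "T \<in> N"
  shows "\<Phi> (S - T) = \<Phi> S - \<Phi> T"
proof -
  have "\<Phi> ((S - T) + T) = \<Phi> (S - T) + \<Phi> T"
    using assms(2,4) unital_star_subalgebra_diff[OF assms(1,3,4)]
    unfolding complex_linear_on_def by blast
  then show ?thesis by simp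
qed

text \<open>The norm bound is recast as positivity of c 1 + y and c 1 - y, because positivity is
  what \<Phi> preserves; linearity and \<Phi>(1) = 1 let \<Phi> pass through the shift. Realness is
  part of the conclusion since the norm is recovered from the form only for real forms.\<close>

lemma channel_contractive:
  assumes N: "unital_star_subalgebra N" and ch: "channel N \<Phi>" and n: "n \<ge> 1"
    and y: "y \<in> mats n N" "opmat_real_form n y" "opmat_bound n y c" and c: "0 \<le> c"
  shows "opmat_real_form n (map_mat \<Phi> y) \<and> opmat_bound n (map_mat \<Phi> y) c"
proof -
  \<comment> \<open>Cauchy-Schwarz turns the norm bound into a two-sided bound on the form, which
    the two shifts can express.\<close>
  have form: "\<bar>Re (opmat_form n y f f)\<bar> \<le> c * (tuple_norm n f)\<^sup>2" for f
  proof -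
    have "tuple_norm n (opmat_act n y f) \<le> c * tuple_norm n f"
      using y(3) by (simp add: opmat_bound_def)
    then have "tuple_norm n f * tuple_norm n (opmat_act n y f) \<le> tuple_norm n f * (c * tuple_norm n f)"
      by (rule mult_left_mono) simp
    then show ?thesis
      using Re_opmat_form_le[of n y f f] by (simp add: power2_eq_square mult.left_commute)
  qed
  have pos: "opmat_positive (opmat_shift n c s (map_mat \<Phi> y))" if s: "s = 1 \<or> s = -1" for s
  proof -
    have mem: "c' *\<^sub>C 1 \<in> N" "s' *\<^sub>C y $$ (i, j) \<in> N" if "i < n" "j < n" for c' s' i j
      using N y(1) that by (auto simp: unital_star_subalgebra_def mats_def)
    have "opmat_shift n c s y \<in> mats n N"
      using N mem by (intro matsI) (auto simp: opmat_shift_def unital_star_subalgebra_def)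
    moreover have "opmat_positive (opmat_shift n c s y)"
      using s form y(2) by (auto simp: opmat_positive_shift_iff abs_le_iff) (smt (verit) form)+
    ultimately have "opmat_positive (map_mat \<Phi> (opmat_shift n c s y))"
      using ch n by (auto simp: channel_def completely_positive_on_def)
    also have "map_mat \<Phi> (opmat_shift n c s y) = opmat_shift n c s (map_mat \<Phi> y)"
    proof (rule eq_matI)
      fix i j assume "i < dim_row (opmat_shift n c s (map_mat \<Phi> y))"
        "j < dim_col (opmat_shift n c s (map_mat \<Phi> y))"
      then have ij: "i < n" "j < n" by (simp_all add: opmat_shift_def)
      have lin: "\<Phi> (S + T) = \<Phi> S + \<Phi> T" "\<Phi> (d *\<^sub>C T) = d *\<^sub>C \<Phi> T" if "S \<in> N" "T \<in> N" for S T d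
        using ch that by (auto simp: channel_def complex_linear_on_def)
      have "1 \<in> N" "y $$ (i, j) \<in> N" "\<Phi> 1 = 1"
        using N y(1) ij ch by (auto simp: unital_star_subalgebra_def mats_def channel_def)
      then show "map_mat \<Phi> (opmat_shift n c s y) $$ (i, j) =
          opmat_shift n c s (map_mat \<Phi> y) $$ (i, j)"
        \<comment> \<open>The zero rule is withheld so that an off-diagonal
          \<open>0 *\<^sub>C 1\<close> stays a multiple of 1, to which \<open>mem\<close> and
          linearity apply as on the diagonal.\<close>
        using ij mem[OF ij] mats_carrier[OF y(1)]
        by (simp add: opmat_shift_def lin del: scaleC_zero_left)
    qed (simp_all add: opmat_shift_def)
    finally show ?thesis .
  qed
  have real: "opmat_real_form n (map_mat \<Phi> y)"
    using pos[of 1] by (simp add: opmat_positive_shift_iff)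
  moreover have "opmat_bound n (map_mat \<Phi> y) c"
  proof (rule opmat_bound_of_form[OF real c])
    fix f
    show "\<bar>Re (opmat_form n (map_mat \<Phi> y) f f)\<bar> \<le> c * (tuple_norm n f)\<^sup>2"
      using pos[of 1] pos[of "-1"] by (auto simp: opmat_positive_shift_iff abs_le_iff algebra_simps)
        (smt (verit))+
  qed
  ultimately show ?thesis by simp
qed

text \<open>\<Phi> contracts y = \<Psi>(x) - x as soon as y has a real form. Formulated over N and
  without semi-norms, the estimate serves both costs.\<close>

lemma opmat_norm_comp_le:
  assumes N: "unital_star_subalgebra N" and ch: "channel N \<Phi>" "channel N \<Psi>" and n: "n \<ge> 1"
    and x: "x \<in> mats n N" "opmat_adj x = x"
  shows "opmat_norm (map_mat (\<Phi> \<circ> \<Psi>) x - x) \<le>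
    opmat_norm (map_mat \<Phi> x - x) + opmat_norm (map_mat \<Psi> x - x)"
proof -
  define y where "y = map_mat \<Psi> x - x"
  have xc: "x \<in> carrier_mat n n" using x(1) by (rule mats_carrier)
  have real: "opmat_real_form n x" using xc x(2) by (rule opmat_real_form_self_adjoint)
  have \<Psi>N: "\<Psi> T \<in> N" if "T \<in> N" for T using ch(2) that by (auto simp: channel_def)
  \<comment> \<open>Only realness is extracted here; the norm of x is just some admissible bound for
    \<open>channel_contractive\<close>.\<close>
  have "opmat_real_form n (map_mat \<Psi> x)"
    using channel_contractive[OF N ch(2) n x(1) real opmat_bound_opmat_norm[OF xc]
        opmat_norm_nonneg[OF xc]] by simp
  then have y: "opmat_real_form n y"
    unfolding y_def using xc real by (intro opmat_real_form_diff) auto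
  have yc: "y \<in> carrier_mat n n" using xc by (simp add: y_def minus_carrier_mat)
  have yN: "y \<in> mats n N"
    using x(1) \<Psi>N unital_star_subalgebra_diff[OF N] by (auto simp: y_def mats_def)
  have le: "opmat_norm (map_mat \<Phi> y) \<le> opmat_norm y"
    using channel_contractive[OF N ch(1) n yN y opmat_bound_opmat_norm[OF yc] opmat_norm_nonneg[OF yc]]
      opmat_norm_nonneg[OF yc] yc by (intro opmat_norm_le[of _ n]) auto
  \<comment> \<open>Linearity of \<Phi> on N splits \<Phi>(y) entrywise, and the two occurrences of
    \<Phi>(x) cancel.\<close>
  have "map_mat (\<Phi> \<circ> \<Psi>) x - x = map_mat \<Phi> y + (map_mat \<Phi> x - x)"
  proof (rule eq_matI)
    fix i j assume "i < dim_row (map_mat \<Phi> y + (map_mat \<Phi> x - x))"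
      "j < dim_col (map_mat \<Phi> y + (map_mat \<Phi> x - x))"
    then have ij: "i < n" "j < n" using xc by auto
    then have "\<Phi> (\<Psi> (x $$ (i, j)) - x $$ (i, j)) = \<Phi> (\<Psi> (x $$ (i, j))) - \<Phi> (x $$ (i, j))"
      using complex_linear_on_diff[OF N] ch(1) x(1) \<Psi>N by (auto simp: channel_def mats_def)
    then show "(map_mat (\<Phi> \<circ> \<Psi>) x - x) $$ (i, j) = (map_mat \<Phi> y + (map_mat \<Phi> x - x)) $$ (i, j)"
      using ij xc by (simp add: y_def)
  qed (use xc in \<open>auto simp: y_def\<close>)
  then have "opmat_norm (map_mat (\<Phi> \<circ> \<Psi>) x - x) \<le>
      opmat_norm (map_mat \<Phi> y) + opmat_norm (map_mat \<Phi> x - x)"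
    using opmat_norm_triangle[of "map_mat \<Phi> y" n "map_mat \<Phi> x - x"] xc yc
    by (simp add: minus_carrier_mat)
  then show ?thesis using le by (simp add: y_def)
qed

section \<open>Operators as 1 x 1 matrices\<close>

lemma opmat_bound_singleton:
  "opmat_bound 1 (mat 1 1 (\<lambda>_. T)) c \<longleftrightarrow> (\<forall>v. norm (bop_apply T v) \<le> c * norm v)"
proof -
  have "opmat_bound 1 (mat 1 1 (\<lambda>_. T)) c \<longleftrightarrow> (\<forall>f. norm (bop_apply T (f 0)) \<le> c * norm (f (0::nat)))"
    by (simp add: opmat_bound_def tuple_norm_def L2_set_def opmat_act_def)
  also have "\<dots> \<longleftrightarrow> (\<forall>v. norm (bop_apply T v) \<le> c * norm v)"
  proof (intro iffI allI)
    fix v assume "\<forall>f. norm (bop_apply T (f 0)) \<le> c * norm (f (0::nat))"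
    from spec[OF this, of "\<lambda>_. v"] show "norm (bop_apply T v) \<le> c * norm v" .
  qed simp
  finally show ?thesis .
qed

text \<open>Both sides are least bounds for the same inequality. Since the identification with 1 x 1
  matrices is isometric, the estimate needed for \<open>Cost\<close> is the case n = 1 of the matrix
  estimate.\<close>

lemma opmat_norm_singleton: "opmat_norm (mat 1 1 (\<lambda>_. T)) = norm T"
proof (rule antisym)
  show "opmat_norm (mat 1 1 (\<lambda>_. T)) \<le> norm T"
    by (rule opmat_norm_le[of _ 1]) (simp_all only: mat_carrier opmat_bound_singleton norm_bop_apply
        norm_ge_zero simp_thms)
  have "opmat_bound 1 (mat 1 1 (\<lambda>_. T)) (opmat_norm (mat 1 1 (\<lambda>_. T)))"
    "0 \<le> opmat_norm (mat 1 1 (\<lambda>_. T))"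
    by (rule opmat_bound_opmat_norm opmat_norm_nonneg[of _ 1]; simp)+
  then have "\<forall>v. norm (bop_apply T v) \<le> opmat_norm (mat 1 1 (\<lambda>_. T)) * norm v"
    "0 \<le> opmat_norm (mat 1 1 (\<lambda>_. T))"
    unfolding opmat_bound_singleton by auto
  then show "norm T \<le> opmat_norm (mat 1 1 (\<lambda>_. T))"
    unfolding norm_bop.rep_eq bop_apply.rep_eq by (intro norm_blinfun_bound) auto
qed

lemma norm_comp_le:
  assumes "unital_star_subalgebra N" "channel N \<Phi>" "channel N \<Psi>" "x \<in> N" "adj x = x"
  shows "norm ((\<Phi> \<circ> \<Psi>) x - x) \<le> norm (\<Phi> x - x) + norm (\<Psi> x - x)"
proof -
  have *: "map_mat f (mat 1 1 (\<lambda>_. x)) - mat 1 1 (\<lambda>_. x) = mat 1 1 (\<lambda>_. f x - x)"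
    for f :: "'a bop \<Rightarrow> 'a bop"
    by (rule eq_matI) simp_all
  have "mat 1 1 (\<lambda>_. x) \<in> mats 1 N" "opmat_adj (mat 1 1 (\<lambda>_. x)) = mat 1 1 (\<lambda>_. x)"
    using assms(4,5) by (auto simp: mats_def opmat_adj_def)
  from opmat_norm_comp_le[OF assms(1-3) order_refl this] show ?thesis
    unfolding * opmat_norm_singleton .
qed

lemma opmat_norm_zero [simp]: "opmat_norm (0\<^sub>m n n) = 0"
proof (rule antisym)
  show "opmat_norm (0\<^sub>m n n) \<le> 0"
    by (rule opmat_norm_le[of _ n]) (simp_all add: opmat_bound_def tuple_norm_def opmat_act_def L2_set_def)
qed (rule opmat_norm_nonneg[of _ n], simp)

section \<open>The three properties of the costs\<close>

lemma Cost_leI: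
  assumes "\<And>x. x \<in> A \<Longrightarrow> adj x = x \<Longrightarrow> L 1 (mat 1 1 (\<lambda>_. x)) \<le> 1 \<Longrightarrow> ennreal (norm (\<Phi> x - x)) \<le> C"
  shows "Cost A L \<Phi> \<le> C"
  unfolding Cost_def by (rule SUP_least) (use assms in auto)

lemma norm_le_Cost:
  assumes "x \<in> A" "adj x = x" "L 1 (mat 1 1 (\<lambda>_. x)) \<le> 1"
  shows "ennreal (norm (\<Phi> x - x)) \<le> Cost A L \<Phi>"
  unfolding Cost_def by (rule SUP_upper) (use assms in auto)

lemma Cost_cb_leI:
  assumes "\<And>n x. n \<ge> 1 \<Longrightarrow> x \<in> mats n A \<Longrightarrow> opmat_adj x = x \<Longrightarrow> L n x \<le> 1 \<Longrightarrow>
    ennreal (opmat_norm (map_mat \<Phi> x - x)) \<le> C"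
  shows "Cost_cb A L \<Phi> \<le> C"
  unfolding Cost_cb_def by (intro SUP_least) (use assms in auto)

lemma opmat_norm_le_Cost_cb:
  assumes "n \<ge> 1" "x \<in> mats n A" "opmat_adj x = x" "L n x \<le> 1"
  shows "ennreal (opmat_norm (map_mat \<Phi> x - x)) \<le> Cost_cb A L \<Phi>"
  unfolding Cost_cb_def
  by (rule SUP_upper2[of n]) (use assms in \<open>auto intro!: SUP_upper\<close>)

lemma Cost_id: "Cost A L id = 0"
proof -
  have "Cost A L id \<le> 0" by (rule Cost_leI) simp
  then show ?thesis by simp
qed

lemma Cost_cb_id: "Cost_cb A L id = 0"
proof -
  have "Cost_cb A L id \<le> 0"
  proof (rule Cost_cb_leI)
    fix n x assume "x \<in> mats n A"
    then have "map_mat id x - x = 0\<^sub>m n n" by (intro eq_matI) (auto simp: mats_def)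
    then show "ennreal (opmat_norm (map_mat id x - x)) \<le> 0" by simp
  qed
  then show ?thesis by simp
qed

text \<open>The pointwise estimate evaluates both channels at the same x, which lies in the
  Lipschitz ball over which both suprema run.\<close>

lemma Cost_comp_le:
  assumes "unital_star_subalgebra N" "A \<subseteq> N" "channel N \<Phi>" "channel N \<Psi>"
  shows "Cost A L (\<Phi> \<circ> \<Psi>) \<le> Cost A L \<Phi> + Cost A L \<Psi>"
proof (rule Cost_leI)
  fix x assume x: "x \<in> A" "adj x = x" "L 1 (mat 1 1 (\<lambda>_. x)) \<le> 1"
  have "ennreal (norm ((\<Phi> \<circ> \<Psi>) x - x)) \<le> ennreal (norm (\<Phi> x - x) + norm (\<Psi> x - x))"
    using norm_comp_le[OF assms(1,3,4) _ x(2)] x(1) assms(2) by (intro ennreal_leI) blast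
  also have "\<dots> = ennreal (norm (\<Phi> x - x)) + ennreal (norm (\<Psi> x - x))" by simp
  also have "\<dots> \<le> Cost A L \<Phi> + Cost A L \<Psi>"
    by (intro add_mono norm_le_Cost x)
  finally show "ennreal (norm ((\<Phi> \<circ> \<Psi>) x - x)) \<le> Cost A L \<Phi> + Cost A L \<Psi>" .
qed

lemma Cost_cb_comp_le:
  assumes "unital_star_subalgebra N" "A \<subseteq> N" "channel N \<Phi>" "channel N \<Psi>"
  shows "Cost_cb A L (\<Phi> \<circ> \<Psi>) \<le> Cost_cb A L \<Phi> + Cost_cb A L \<Psi>"
proof (rule Cost_cb_leI)
  fix n x assume x: "n \<ge> 1" "x \<in> mats n A" "opmat_adj x = x" "L n x \<le> 1"
  have xN: "x \<in> mats n N" using x(2) assms(2) by (auto simp: mats_def)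
  \<comment> \<open>\<open>ennreal\<close> sends negative reals to 0, so it is split over a sum only
    for nonnegative summands.\<close>
  then have nonneg: "0 \<le> opmat_norm (map_mat f x - x)" for f
    by (intro opmat_norm_nonneg[of _ n] minus_carrier_mat) (rule mats_carrier)
  have "ennreal (opmat_norm (map_mat (\<Phi> \<circ> \<Psi>) x - x)) \<le>
      ennreal (opmat_norm (map_mat \<Phi> x - x) + opmat_norm (map_mat \<Psi> x - x))"
    by (intro ennreal_leI opmat_norm_comp_le[OF assms(1,3,4) x(1) xN x(3)])
  also have "\<dots> = ennreal (opmat_norm (map_mat \<Phi> x - x)) + ennreal (opmat_norm (map_mat \<Psi> x - x))"
    using nonneg by simp
  also have "\<dots> \<le> Cost_cb A L \<Phi> + Cost_cb A L \<Psi>"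
    by (intro add_mono opmat_norm_le_Cost_cb[of n x A L, OF x])
  finally show "ennreal (opmat_norm (map_mat (\<Phi> \<circ> \<Psi>) x - x)) \<le> Cost_cb A L \<Phi> + Cost_cb A L \<Psi>" .
qed

text \<open>Writing x as p1 x + p2 x makes the displacement of x a convex combination of the two
  displacements; the triangle inequality does the rest.\<close>

lemma Cost_convex_combination_le:
  fixes p1 p2 :: real
  assumes "0 \<le> p1" "0 \<le> p2" "p1 + p2 = 1"
  shows "Cost A L (\<lambda>x. p1 *\<^sub>R \<Phi> x + p2 *\<^sub>R \<Psi> x) \<le>
    ennreal p1 * Cost A L \<Phi> + ennreal p2 * Cost A L \<Psi>"
proof (rule Cost_leI)
  fix x assume x: "x \<in> A" "adj x = x" "L 1 (mat 1 1 (\<lambda>_. x)) \<le> 1"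
  have "p1 *\<^sub>R \<Phi> x + p2 *\<^sub>R \<Psi> x - x = p1 *\<^sub>R \<Phi> x + p2 *\<^sub>R \<Psi> x - (p1 + p2) *\<^sub>R x"
    by (simp add: assms(3))
  also have "\<dots> = p1 *\<^sub>R (\<Phi> x - x) + p2 *\<^sub>R (\<Psi> x - x)"
    by (simp add: algebra_simps)
  finally have "norm (p1 *\<^sub>R \<Phi> x + p2 *\<^sub>R \<Psi> x - x) \<le> p1 * norm (\<Phi> x - x) + p2 * norm (\<Psi> x - x)"
    using norm_triangle_ineq[of "p1 *\<^sub>R (\<Phi> x - x)" "p2 *\<^sub>R (\<Psi> x - x)"] assms(1,2) by simp
  then have "ennreal (norm (p1 *\<^sub>R \<Phi> x + p2 *\<^sub>R \<Psi> x - x)) \<le>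
      ennreal p1 * ennreal (norm (\<Phi> x - x)) + ennreal p2 * ennreal (norm (\<Psi> x - x))"
    using assms(1,2) by (simp add: ennreal_leI flip: ennreal_mult ennreal_plus)
  \<comment> \<open>A weight 0 against an infinite cost gives 0 on the right; the step survives
    because the matching term on the left is 0 as well.\<close>
  also have "\<dots> \<le> ennreal p1 * Cost A L \<Phi> + ennreal p2 * Cost A L \<Psi>"
    by (intro add_mono mult_left_mono norm_le_Cost x) simp_all
  finally show "ennreal (norm (p1 *\<^sub>R \<Phi> x + p2 *\<^sub>R \<Psi> x - x)) \<le>
      ennreal p1 * Cost A L \<Phi> + ennreal p2 * Cost A L \<Psi>" .
qed

theorem proposition3p4:
  fixes N A :: "'h :: complex_hilbert bop set"
    and L :: "nat \<Rightarrow> 'h bop mat \<Rightarrow> real"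
  assumes "von_neumann_algebra N"
    and "unital_star_subalgebra A"
    and "weak_star_dense_in A N"
    and "matrix_lipschitz_seminorm A L"
  shows "(Cost A L id = 0 \<and> Cost_cb A L id = 0) \<and>
    (\<forall>\<Phi> \<Psi>. channel N \<Phi> \<and> \<Phi> ` A \<subseteq> A \<and> channel N \<Psi> \<and> \<Psi> ` A \<subseteq> A \<longrightarrow>
      Cost A L (\<Phi> \<circ> \<Psi>) \<le> Cost A L \<Phi> + Cost A L \<Psi> \<and>
      Cost_cb A L (\<Phi> \<circ> \<Psi>) \<le> Cost_cb A L \<Phi> + Cost_cb A L \<Psi>) \<and>
    (\<forall>\<Phi> \<Psi>. \<forall>p1\<in>{0..1}. \<forall>p2\<in>{0..1}.
      channel N \<Phi> \<and> \<Phi> ` A \<subseteq> A \<and> channel N \<Psi> \<and> \<Psi> ` A \<subseteq> A \<and> p1 + p2 = 1 \<longrightarrow>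
      Cost A L (\<lambda>x. p1 *\<^sub>R \<Phi> x + p2 *\<^sub>R \<Psi> x) \<le>
        ennreal p1 * Cost A L \<Phi> + ennreal p2 * Cost A L \<Psi>)"
proof -
  have N: "unital_star_subalgebra N" and A: "A \<subseteq> N"
    using assms by (auto simp: von_neumann_algebra_def weak_star_dense_in_def)
  show ?thesis
    by (auto intro!: Cost_id Cost_cb_id Cost_comp_le[OF N A] Cost_cb_comp_le[OF N A]
        Cost_convex_combination_le)
qed

end
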